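(* Let $n,m,k$ be integers with $m\ge 1$ and $1\le k<n$, and let $(p_{ij})\in\{0,1\}^{n\times m}$ be a matrix of voters' preference profiles. Then the mixed-integer linear program, in the variables $x\in\{0,1\}^m$, $z=(z_{ij})\in\mathbb{R}^{n\times m}$, $d=(d_i)\in\mathbb{R}^n$, $v=(v_i)\in\mathbb{R}^n$, $t\in\mathbb{R}$, $$\begin{aligned}\min\ & kt+\sum_{i=1}^n v_i\\ \text{s.t. } & v_i\ge d_i-t && i=1,\dots,n,\\ & d_i\ge\sum_{j=1}^m z_{ij} && i=1,\dots,n,\\ & z_{ij}\ge x_j(1-p_{ij})+p_{ij}(1-x_j) && i=1,\dots,n,\ j=1,\dots,m,\\ & x_j\in\{0,1\} && j=1,\dots,m,\\ & t\ge 0,\ v_i\ge 0 && i=1,\dots,n\end{aligned}$$ is a valid formulation of the $k$-sum approval voting problem; that is, its optimal value equals the optimal value of the $k$-sum approval voting problem, and a committee $x\in\{0,1\}^m$ is optimal for the $k$-sum approval voting problem if and only if $x$ is the $x$-part of some optimal solution of the program.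
   Context: There are $n$ voters and $m$ candidates. The preference profile of voter $i$ is the vector $P_i=(p_{i1},\dots,p_{im})\in\{0,1\}^m$, with $p_{ij}=1$ if and only if voter $i$ approves candidate $j$. A committee is a vector $x\in\{0,1\}^m$ (no constraint on its size). The Hamming distance of voter $i$ to $x$ is $d_i(x)=\sum_{j=1}^m|p_{ij}-x_j|$. The $k$-sum approval voting problem is to find $x\in\{0,1\}^m$ minimizing the sum of the $k$ largest among the $n$ numbers $d_1(x),\dots,d_n(x)$ (counted with multiplicity); its optimal value is this minimum. *)

theory Defs
  imports "HOL-Analysis.Analysis" "HOL-Library.Multiset"
begin

text \<open>
  Voters are indexed by the finite type \<open>'n\<close> and candidates by the finite type \<open>'m\<close>.
  A matrix \<open>p\<close> has type \<open>real ^ 'm ^ 'n\<close>, so its row \<open>p $ i\<close> is the preference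
  profile of voter \<open>i\<close>. Committees and profiles are real vectors with entries in \<open>{0, 1}\<close>.
\<close>

definition binary_vec :: "real ^ 'm \<Rightarrow> bool" where
  "binary_vec x \<longleftrightarrow> (\<forall>j. x $ j \<in> {0, 1})"

definition hamming :: "real ^ 'm ^ 'n \<Rightarrow> real ^ 'm \<Rightarrow> 'n \<Rightarrow> real" where
  "hamming p x i = (\<Sum>j\<in>UNIV. \<bar>p $ i $ j - x $ j\<bar>)"

definition sum_largest :: "nat \<Rightarrow> real multiset \<Rightarrow> real" where
  "sum_largest k M = sum_list (take k (rev (sorted_list_of_multiset M)))"

definition ksum_objective :: "nat \<Rightarrow> real ^ 'm ^ 'n \<Rightarrow> real ^ 'm \<Rightarrow> real" where
  "ksum_objective k p x = sum_largest k (image_mset (hamming p x) (mset_set UNIV))"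

text \<open>
  The optimal value of a minimization problem, as a relation: it holds for no \<open>c\<close> if
  the minimum is not attained (in particular if the problem is infeasible or unbounded),
  and for exactly one \<open>c\<close> otherwise.
\<close>

definition is_optimal_value :: "('a \<Rightarrow> real) \<Rightarrow> ('a \<Rightarrow> bool) \<Rightarrow> real \<Rightarrow> bool" where
  "is_optimal_value f feasible c \<longleftrightarrow> (\<exists>s. is_arg_min f feasible s \<and> f s = c)"

type_synonym ('n, 'm) milp_point =
  "(real ^ 'm) \<times> (real ^ 'm ^ 'n) \<times> (real ^ 'n) \<times> (real ^ 'n) \<times> real"

definition milp_objective :: "nat \<Rightarrow> ('n::finite, 'm::finite) milp_point \<Rightarrow> real" where
  "milp_objective k = (\<lambda>(x, z, d, v, t). real k * t + (\<Sum>i\<in>UNIV. v $ i))"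

definition milp_feasible :: "real ^ 'm::finite ^ 'n::finite \<Rightarrow> ('n, 'm) milp_point \<Rightarrow> bool" where
  "milp_feasible p = (\<lambda>(x, z, d, v, t).
     (\<forall>i. v $ i \<ge> d $ i - t) \<and>
     (\<forall>i. d $ i \<ge> (\<Sum>j\<in>UNIV. z $ i $ j)) \<and>
     (\<forall>i j. z $ i $ j \<ge> x $ j * (1 - p $ i $ j) + p $ i $ j * (1 - x $ j)) \<and>
     binary_vec x \<and>
     t \<ge> 0 \<and> (\<forall>i. v $ i \<ge> 0))"

end

theory Submission
  imports Defs
begin

text \<open>
  For a decreasing list and \<open>t \<ge> 0\<close>, the sum of the first \<open>k\<close> entries is at most
  \<open>k * t\<close> plus the total excess of the entries over \<open>t\<close>, with equality if \<open>t\<close> is the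
  \<open>k\<close>-th entry. For a fixed committee the program minimizes this upper bound over \<open>t\<close>,
  because the cheapest \<open>z\<close>, \<open>d\<close>, \<open>v\<close> make all their constraints tight; so the \<open>k\<close>-sum
  objective is the partial minimum of the program's objective, and minimizing over the
  finitely many committees gives the claim.
\<close>

text \<open>Each taken entry \<open>a\<close> is at most \<open>t + max 0 (a - t)\<close>, and the
  entries left out only add nonnegative excesses. The assumption \<open>0 \<le> t\<close> covers
  lists with fewer than \<open>k\<close> entries.\<close>

lemma sum_list_take_le:
  fixes t :: real
  assumes "0 \<le> t"
  shows "sum_list (take k xs) \<le> real k * t + (\<Sum>a\<leftarrow>xs. max 0 (a - t))"
proof (induction xs arbitrary: k)
  case Nil
  then show ?case using assms by simp
next
  case (Cons a xs)
  show ?case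
  proof (cases k)
    case 0
    have "0 \<le> (\<Sum>a\<leftarrow>a # xs. max 0 (a - t))"
      by (intro sum_list_nonneg) auto
    then show ?thesis using 0 by simp
  next
    case (Suc l)
    then show ?thesis using Cons.IH[of l] by (simp add: algebra_simps)
  qed
qed

lemma sum_list_take_eq:
  fixes xs :: "real list"
  assumes sorted: "sorted_wrt (\<ge>) xs" and k: "1 \<le> k" "k \<le> length xs"
  defines "t \<equiv> xs ! (k - 1)"
  shows "sum_list (take k xs) = real k * t + (\<Sum>a\<leftarrow>xs. max 0 (a - t))"
proof -
  have mono: "xs ! j \<le> xs ! i" if "i \<le> j" "j < length xs" for i j
    using that sorted by (cases "i = j") (auto simp: sorted_wrt_iff_nth_less)
  \<comment> \<open>Indices start at 0, so \<open>t\<close> is the last entry of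
    \<open>take k xs\<close>. Up to there the excess is exactly \<open>a - t\<close>; beyond it the
    excess vanishes.\<close>
  have "t \<le> a" if "a \<in> set (take k xs)" for a
    using that k mono unfolding t_def by (auto simp: in_set_conv_nth)
  then have "(\<Sum>a\<leftarrow>take k xs. max 0 (a - t)) = (\<Sum>a\<leftarrow>take k xs. a - t)"
    by (intro arg_cong[where f = sum_list] map_cong) auto
  also have "\<dots> = sum_list (take k xs) - real k * t"
    using k by (simp add: sum_list_subtractf sum_list_triv)
  finally have "(\<Sum>a\<leftarrow>take k xs. max 0 (a - t)) = sum_list (take k xs) - real k * t" .
  moreover have "a \<le> t" if "a \<in> set (drop k xs)" for a
    using that k mono unfolding t_def by (auto simp: in_set_conv_nth)
  then have "(\<Sum>a\<leftarrow>drop k xs. max 0 (a - t)) = (\<Sum>a\<leftarrow>drop k xs. 0)"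
    by (intro arg_cong[where f = sum_list] map_cong) auto
  moreover have "(\<Sum>a\<leftarrow>xs. max 0 (a - t)) =
      (\<Sum>a\<leftarrow>take k xs. max 0 (a - t)) + (\<Sum>a\<leftarrow>drop k xs. max 0 (a - t))"
    by (metis append_take_drop_id map_append sum_list_append)
  ultimately show ?thesis by (simp add: sum_list_triv)
qed

text \<open>Summation ignores order, so passing to the multiset undoes the sorting. This turns
  excess sums over the sorted distances into sums over voters.\<close>

lemma sum_list_rev_sorted_list_of_multiset:
  "sum_list (map f (rev (sorted_list_of_multiset (image_mset g (mset_set A))))) = (\<Sum>i\<in>A. f (g i))"
  for f :: "_ \<Rightarrow> real"
proof -
  have "sum_list (map f (rev (sorted_list_of_multiset (image_mset g (mset_set A))))) =
      sum_mset (mset (map f (rev (sorted_list_of_multiset (image_mset g (mset_set A))))))"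
    by (simp only: sum_mset_sum_list)
  also have "\<dots> = (\<Sum>i\<in>A. f (g i))"
    by (simp add: image_mset.compositionality sum_unfold_sum_mset comp_def)
  finally show ?thesis .
qed

lemma ksum_objective_le:
  fixes p :: "real ^ 'm ^ 'n"
  assumes "0 \<le> t"
  shows "ksum_objective k p x \<le> real k * t + (\<Sum>i\<in>UNIV. max 0 (hamming p x i - t))"
  using sum_list_take_le[OF assms]
    sum_list_rev_sorted_list_of_multiset[of "\<lambda>a. max 0 (a - t)" "hamming p x" UNIV]
  unfolding ksum_objective_def sum_largest_def by metis

lemma hamming_nonneg: "0 \<le> hamming p x i"
  unfolding hamming_def by (simp add: sum_nonneg)

lemma ksum_objective_attained:
  fixes p :: "real ^ 'm ^ 'n"
  assumes "1 \<le> k" "k \<le> CARD('n)"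
  obtains t where "0 \<le> t"
    "ksum_objective k p x = real k * t + (\<Sum>i\<in>UNIV. max 0 (hamming p x i - t))"
proof -
  define M where "M = image_mset (hamming p x) (mset_set UNIV)"
  define xs where "xs = rev (sorted_list_of_multiset M)"
  have sorted: "sorted_wrt (\<ge>) xs"
    unfolding xs_def by (simp add: sorted_wrt_rev)
  have "length xs = size M"
    unfolding xs_def by (metis length_rev mset_sorted_list_of_multiset size_mset)
  then have len: "k \<le> length xs"
    using assms by (simp add: M_def)
  \<comment> \<open>The witness for \<open>t\<close> is the \<open>k\<close>-th largest distance;
    being the distance of some voter, it is nonnegative.\<close>
  have "xs ! (k - 1) \<in> set xs"
    using assms len by (intro nth_mem) auto
  then have "0 \<le> xs ! (k - 1)"
    unfolding xs_def M_def by (auto simp: hamming_nonneg)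
  moreover have "ksum_objective k p x = sum_list (take k xs)"
    unfolding ksum_objective_def sum_largest_def xs_def M_def ..
  moreover have "(\<Sum>a\<leftarrow>xs. max 0 (a - t)) = (\<Sum>i\<in>UNIV. max 0 (hamming p x i - t))" for t
    unfolding xs_def M_def by (rule sum_list_rev_sorted_list_of_multiset)
  ultimately show ?thesis
    using that sum_list_take_eq[OF sorted assms(1) len] by simp
qed

text \<open>This linearizes the Hamming distance: for a fixed profile entry \<open>a\<close>, the
  right-hand side is affine in the committee entry \<open>b\<close>.\<close>

lemma binary_abs_diff:
  fixes a b :: real
  assumes "a \<in> {0, 1}" "b \<in> {0, 1}"
  shows "\<bar>a - b\<bar> = b * (1 - a) + a * (1 - b)"
  using assms by auto

lemma hamming_binary:
  assumes "binary_vec (p $ i)" "binary_vec x"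
  shows "hamming p x i = (\<Sum>j\<in>UNIV. x $ j * (1 - p $ i $ j) + p $ i $ j * (1 - x $ j))"
  using assms unfolding hamming_def binary_vec_def
  by (intro sum.cong refl binary_abs_diff) auto

lemma milp_objective_ge:
  fixes p :: "real ^ 'm ^ 'n"
  assumes p: "\<forall>i. binary_vec (p $ i)" and feas: "milp_feasible p (x, z, d, v, t)"
  shows "ksum_objective k p x \<le> milp_objective k (x, z, d, v, t)"
proof -
  have "max 0 (hamming p x i - t) \<le> v $ i" for i
  proof -
    \<comment> \<open>The constraints on \<open>z\<close>, \<open>d\<close> and \<open>v\<close>
      chain up to bound \<open>v $ i\<close> below by both 0 and the excess of the true distance
      over \<open>t\<close>.\<close>
    have "hamming p x i \<le> (\<Sum>j\<in>UNIV. z $ i $ j)"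
      using feas p by (simp add: hamming_binary milp_feasible_def sum_mono)
    also have "\<dots> \<le> d $ i" "d $ i \<le> v $ i + t" "0 \<le> v $ i"
      using feas by (auto simp: milp_feasible_def algebra_simps)
    ultimately show ?thesis by linarith
  qed
  then have "(\<Sum>i\<in>UNIV. max 0 (hamming p x i - t)) \<le> (\<Sum>i\<in>UNIV. v $ i)"
    by (rule sum_mono)
  moreover have "0 \<le> t"
    using feas by (simp add: milp_feasible_def)
  ultimately show ?thesis
    using ksum_objective_le[of t k p x] by (simp add: milp_objective_def)
qed

lemma milp_objective_attained:
  fixes p :: "real ^ 'm ^ 'n"
  assumes p: "\<forall>i. binary_vec (p $ i)" and x: "binary_vec x" and k: "1 \<le> k" "k \<le> CARD('n)"
  shows "\<exists>z d v t. milp_feasible p (x, z, d, v, t) \<and>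
    milp_objective k (x, z, d, v, t) = ksum_objective k p x"
proof -
  obtain t where t: "0 \<le> t"
    "ksum_objective k p x = real k * t + (\<Sum>i\<in>UNIV. max 0 (hamming p x i - t))"
    using ksum_objective_attained[OF k] .
  define z :: "real ^ 'm ^ 'n"
    where "z = (\<chi> i j. x $ j * (1 - p $ i $ j) + p $ i $ j * (1 - x $ j))"
  define d :: "real ^ 'n" where "d = (\<chi> i. hamming p x i)"
  define v :: "real ^ 'n" where "v = (\<chi> i. max 0 (hamming p x i - t))"
  have "milp_feasible p (x, z, d, v, t)"
    using p x t by (simp add: milp_feasible_def z_def d_def v_def hamming_binary)
  moreover have "milp_objective k (x, z, d, v, t) = ksum_objective k p x"
    by (simp add: milp_objective_def v_def t)
  ultimately show ?thesis by blast
qed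

text \<open>Finiteness guarantees that some committee attains the minimum.\<close>

lemma finite_binary_vec: "finite {x :: real ^ 'm. binary_vec x}"
proof -
  have "{x :: real ^ 'm. binary_vec x} \<subseteq> vec_lambda ` (UNIV \<rightarrow>\<^sub>E {0, 1})"
  proof
    fix x :: "real ^ 'm"
    assume "x \<in> {x. binary_vec x}"
    then have "vec_nth x \<in> UNIV \<rightarrow>\<^sub>E {0, 1}"
      by (auto simp: binary_vec_def)
    then show "x \<in> vec_lambda ` (UNIV \<rightarrow>\<^sub>E {0, 1})"
      by (metis image_eqI vec_nth_inverse)
  qed
  then show ?thesis
    by (rule finite_subset) (simp add: finite_PiE)
qed

text \<open>The assumptions say that \<open>g x\<close> is the attained minimum of
  \<open>f (x, y)\<close> over \<open>y\<close>, so minimizing jointly amounts to minimizing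
  \<open>g\<close> and then completing \<open>x\<close> optimally.\<close>

lemma is_arg_min_partial_min_iff:
  fixes f :: "'a \<times> 'b \<Rightarrow> real"
  assumes lower: "\<And>x y. Q (x, y) \<Longrightarrow> P x \<and> g x \<le> f (x, y)"
    and attained: "\<And>x. P x \<Longrightarrow> \<exists>y. Q (x, y) \<and> f (x, y) = g x"
  shows "is_arg_min f Q (x, y) \<longleftrightarrow> is_arg_min g P x \<and> Q (x, y) \<and> f (x, y) = g x"
proof
  assume R: "is_arg_min f Q (x, y)"
  then have Q: "Q (x, y)" and min: "\<And>s. Q s \<Longrightarrow> f (x, y) \<le> f s"
    by (auto simp: is_arg_min_linorder)
  \<comment> \<open>Compare with a completion of \<open>x'\<close> of value \<open>g x'\<close>. The
    case \<open>x' = x\<close> together with \<open>lower\<close> forces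
    \<open>f (x, y) = g x\<close>.\<close>
  have "f (x, y) \<le> g x'" if "P x'" for x'
    using attained[OF that] min by metis
  then show "is_arg_min g P x \<and> Q (x, y) \<and> f (x, y) = g x"
    using lower[OF Q] Q by (force simp: is_arg_min_linorder)
next
  assume "is_arg_min g P x \<and> Q (x, y) \<and> f (x, y) = g x"
  then show "is_arg_min f Q (x, y)"
    using lower by (fastforce simp: is_arg_min_linorder)
qed

theorem theorem3:
  fixes p :: "real ^ 'm ^ 'n" and k :: nat
  assumes "\<forall>i. binary_vec (p $ i)"
    and "1 \<le> k" and "k < CARD('n)"
  shows "(\<exists>c. is_optimal_value (ksum_objective k p) binary_vec c \<and>
              is_optimal_value (milp_objective k) (milp_feasible p) c) \<and>
         (\<forall>x. binary_vec x \<longrightarrow>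
           (is_arg_min (ksum_objective k p) binary_vec x \<longleftrightarrow>
            (\<exists>z d v t. is_arg_min (milp_objective k) (milp_feasible p) (x, z, d, v, t))))"
proof -
  have attained: "\<exists>y. milp_feasible p (x, y) \<and> milp_objective k (x, y) = ksum_objective k p x"
    if "binary_vec x" for x
    using milp_objective_attained[OF assms(1) that assms(2)] assms(3) by force
  have lower: "binary_vec x \<and> ksum_objective k p x \<le> milp_objective k (x, y)"
    if feas: "milp_feasible p (x, y)" for x y
  proof -
    \<comment> \<open>Tuples nest to the right, so the second component \<open>y\<close> packs all
      continuous variables.\<close>
    obtain z d v t where y: "y = (z, d, v, t)" by (metis prod.collapse)
    then have "binary_vec x" using feas by (simp add: milp_feasible_def)
    then show ?thesis using milp_objective_ge[OF assms(1)] feas y by blast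
  qed
  note iff = is_arg_min_partial_min_iff[of "milp_feasible p" binary_vec "ksum_objective k p"
      "milp_objective k", OF lower attained]
  have ex: "\<exists>y. is_arg_min (milp_objective k) (milp_feasible p) (x, y) \<and>
      milp_objective k (x, y) = ksum_objective k p x"
    if "is_arg_min (ksum_objective k p) binary_vec x" for x
    using that attained iff unfolding is_arg_min_def by metis
  \<comment> \<open>The empty committee shows that there is something to minimize over.\<close>
  have "binary_vec (0 :: real ^ 'm)"
    by (simp add: binary_vec_def)
  then obtain x where x: "is_arg_min (ksum_objective k p) binary_vec x"
    using ex_is_arg_min_if_finite[OF finite_binary_vec, of "ksum_objective k p"] by auto
  then have "is_optimal_value (ksum_objective k p) binary_vec (ksum_objective k p x)"
    "is_optimal_value (milp_objective k) (milp_feasible p) (ksum_objective k p x)"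
    using ex[OF x] unfolding is_optimal_value_def by blast+
  moreover have "is_arg_min (ksum_objective k p) binary_vec x \<longleftrightarrow>
      (\<exists>z d v t. is_arg_min (milp_objective k) (milp_feasible p) (x, z, d, v, t))" for x
    using ex[of x] iff by (metis prod.collapse)
  ultimately show ?thesis by blast
qed

end
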